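(* If $G$ is a finite simple graph with independence number $\alpha(G) \le 2$, then $\chi(G) \le \Delta_2(G) + 2$. Equivalently, if $H$ is a finite triangle-free graph, then $\overline{\chi}(H) \le \overline{\Delta_2}(H) + 2$.
   Context: For distinct vertices $u,v$, $\operatorname{codeg}(u,v)$ is the number of common neighbors, and $\Delta_2(G)=\max_{u\ne v}\operatorname{codeg}(u,v)$. The anti-codegree of vertices $v,w$ of $H$ is $\overline{\operatorname{codeg}}(v,w) = |V(H)\setminus(N(v)\cup N(w)\cup\{v,w\})|$, and $\overline{\Delta_2}(H)=\max_{v,w}\overline{\operatorname{codeg}}(v,w)$ (which equals $\Delta_2$ of the complement of $H$). $\overline{\chi}(H)$ is the clique cover number of $H$, i.e. the minimum number of cliques needed to cover $V(H)$. *)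

theory Defs
  imports Complex_Main "HOL-Library.Ramsey"
begin

text \<open>A graph is a vertex set \<open>V\<close> together with a set \<open>E\<close> of two-element subsets of \<open>V\<close>.
  Cliques and independent sets are the predicates \<^const>\<open>clique\<close> and \<^const>\<open>indep\<close> of
  \<^theory>\<open>HOL-Library.Ramsey\<close>.\<close>

definition finite_simple_graph :: "'a set \<Rightarrow> 'a set set \<Rightarrow> bool" where
  "finite_simple_graph V E \<longleftrightarrow> finite V \<and> E \<subseteq> [V]\<^bsup>2\<^esup>"

definition neighbors :: "'a set \<Rightarrow> 'a set set \<Rightarrow> 'a \<Rightarrow> 'a set" where
  "neighbors V E v = {u \<in> V. {u, v} \<in> E}"

definition codeg :: "'a set \<Rightarrow> 'a set set \<Rightarrow> 'a \<Rightarrow> 'a \<Rightarrow> nat" where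
  "codeg V E u v = card (neighbors V E u \<inter> neighbors V E v)"

text \<open>Inserting \<open>0\<close> only matters when there are fewer than two vertices, in which case the
  maximum over pairs of distinct vertices is taken to be \<open>0\<close>.\<close>

definition max_codeg :: "'a set \<Rightarrow> 'a set set \<Rightarrow> nat" where
  "max_codeg V E = Max (insert 0 {codeg V E u v | u v. u \<in> V \<and> v \<in> V \<and> u \<noteq> v})"

definition anti_codeg :: "'a set \<Rightarrow> 'a set set \<Rightarrow> 'a \<Rightarrow> 'a \<Rightarrow> nat" where
  "anti_codeg V E v w = card (V - (neighbors V E v \<union> neighbors V E w \<union> {v, w}))"

definition max_anti_codeg :: "'a set \<Rightarrow> 'a set set \<Rightarrow> nat" where
  "max_anti_codeg V E = Max (insert 0 {anti_codeg V E v w | v w. v \<in> V \<and> w \<in> V \<and> v \<noteq> w})"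

definition independence_number :: "'a set \<Rightarrow> 'a set set \<Rightarrow> nat" where
  "independence_number V E = Max {card S | S. S \<subseteq> V \<and> indep S E}"

definition proper_coloring :: "'a set \<Rightarrow> 'a set set \<Rightarrow> ('a \<Rightarrow> nat) \<Rightarrow> bool" where
  "proper_coloring V E c \<longleftrightarrow> (\<forall>u\<in>V. \<forall>v\<in>V. {u, v} \<in> E \<longrightarrow> c u \<noteq> c v)"

definition chromatic_number :: "'a set \<Rightarrow> 'a set set \<Rightarrow> nat" where
  "chromatic_number V E = (LEAST k. \<exists>c. c ` V \<subseteq> {..<k} \<and> proper_coloring V E c)"

definition clique_cover :: "'a set \<Rightarrow> 'a set set \<Rightarrow> 'a set set \<Rightarrow> bool" where
  "clique_cover V E C \<longleftrightarrow> (\<forall>K\<in>C. K \<subseteq> V \<and> clique K E) \<and> \<Union>C = V"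

definition clique_cover_number :: "'a set \<Rightarrow> 'a set set \<Rightarrow> nat" where
  "clique_cover_number V E = (LEAST k. \<exists>C. finite C \<and> card C = k \<and> clique_cover V E C)"

definition triangle_free :: "'a set \<Rightarrow> 'a set set \<Rightarrow> bool" where
  "triangle_free V E \<longleftrightarrow> \<not> (\<exists>T. T \<subseteq> V \<and> card T = 3 \<and> clique T E)"

text \<open>Sanity check: the maximum anti-codegree is the maximum codegree of the complement. This is
  why both maxima range over pairs of distinct vertices.\<close>

lemma max_anti_codeg_eq_max_codeg_complement:
  "max_anti_codeg V E = max_codeg V ([V]\<^bsup>2\<^esup> - E)"
proof -
  have mem: "{u, v} \<in> [V]\<^bsup>2\<^esup> \<longleftrightarrow> u \<in> V \<and> v \<in> V \<and> u \<noteq> v" for u v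
    by (auto simp: nsets_def card_insert_if)
  have "anti_codeg V E v w = codeg V ([V]\<^bsup>2\<^esup> - E) v w" if "v \<in> V" "w \<in> V" for v w
  proof -
    have "V - (neighbors V E v \<union> neighbors V E w \<union> {v, w})
        = neighbors V ([V]\<^bsup>2\<^esup> - E) v \<inter> neighbors V ([V]\<^bsup>2\<^esup> - E) w"
      using that by (auto simp: neighbors_def mem)
    then show ?thesis
      by (simp add: anti_codeg_def codeg_def)
  qed
  then have "{anti_codeg V E v w | v w. v \<in> V \<and> w \<in> V \<and> v \<noteq> w}
      = {codeg V ([V]\<^bsup>2\<^esup> - E) v w | v w. v \<in> V \<and> w \<in> V \<and> v \<noteq> w}"
    by (intro Collect_cong) metis
  then show ?thesis
    by (simp add: max_anti_codeg_def max_codeg_def)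
qed

end

theory Submission
  imports Defs "HOL-Library.Disjoint_Sets"
begin

text \<open>
  The complement of a graph with independence number at most 2 is triangle-free, so it suffices to
  bound the clique cover number of a triangle-free graph on \<open>n\<close> vertices. A maximum matching \<open>M\<close>
  gives a cover by \<open>n - |M|\<close> cliques, hence two distinct vertices \<open>v, w\<close> whose closed neighbourhoods
  cover at most \<open>|M| + 2\<close> vertices are enough.

  If two vertices are unmatched, they will do: an edge of \<open>M\<close> meets the union of their neighbourhoods
  in at most one point, as otherwise there is a triangle or an augmenting path.

  Otherwise \<open>|M| = \<lfloor>n/2\<rfloor>\<close>. Suppose that no pair works, so that non-adjacent \<open>v, w\<close> have codegree
  \<open>c(v, w) \<le> d(v) + d(w) - (n + 1)/2\<close>. Summing this over the non-neighbours \<open>w\<close> of \<open>v\<close>, and then over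
  \<open>v\<close>, yields an average degree of at least \<open>(n + 1)/3\<close>. Conversely, an edge \<open>ww'\<close> among the
  non-neighbours of \<open>v\<close> satisfies \<open>c(v, w) + c(v, w') \<le> d(v)\<close>; summing over these edges yields an average
  degree of at most \<open>(n + 1)/3\<close>. Hence equality holds throughout: the graph is \<open>d\<close>-regular with
  \<open>n = 3d - 1\<close>, and all non-adjacent pairs have codegree \<open>d/2\<close>. But two vertices with a common neighbour
  outside \<open>N(v)\<close> then have the same \<open>d/2\<close> neighbours in \<open>N(v)\<close>, and so too many common
  neighbours; such vertices exist because the failure of adjacent pairs forces \<open>d \<ge> 4\<close>.
\<close>

section \<open>Basic facts about triangle-free graphs\<close>

lemma edge_imp_vertices:
  assumes "finite_simple_graph V E" "{x, y} \<in> E"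
  shows "x \<in> V" "y \<in> V" "x \<noteq> y"
  using assms by (auto simp: finite_simple_graph_def nsets_def card_insert_if)

locale triangle_free_graph =
  fixes V :: "'a set" and E :: "'a set set"
  assumes simple: "finite_simple_graph V E"
    and no_triangle: "triangle_free V E"
begin

abbreviation N :: "'a \<Rightarrow> 'a set" where "N \<equiv> neighbors V E"
text \<open>Degrees and codegrees are read as integers, since the counting below subtracts them
  freely.\<close>

abbreviation d :: "'a \<Rightarrow> int" where "d v \<equiv> int (card (N v))"
abbreviation c :: "'a \<Rightarrow> 'a \<Rightarrow> int" where "c v w \<equiv> int (codeg V E v w)"
abbreviation W :: "'a \<Rightarrow> 'a set" where "W v \<equiv> V - insert v (N v)"

lemma finite_V [simp]: "finite V"
  using simple by (simp add: finite_simple_graph_def)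

lemma mem_neighbors: "u \<in> N v \<longleftrightarrow> {u, v} \<in> E"
  using edge_imp_vertices(1)[OF simple, of u v] by (auto simp: neighbors_def)

lemma neighbors_sym: "u \<in> N v \<longleftrightarrow> v \<in> N u"
  by (simp add: mem_neighbors insert_commute)

lemma neighbors_irrefl [simp]: "v \<notin> N v"
  using edge_imp_vertices(3)[OF simple, of v v] by (auto simp: mem_neighbors)

lemma neighbors_subset: "N v \<subseteq> V"
  by (auto simp: neighbors_def)

lemma finite_neighbors [simp]: "finite (N v)"
  using neighbors_subset finite_V by (rule finite_subset)

lemma triangleD:
  assumes "x \<in> N z" "y \<in> N z"
  shows "x \<notin> N y"
proof
  assume "x \<in> N y"
  then have "{x, y} \<in> E" "{x, z} \<in> E" "{y, z} \<in> E"
    using assms by (simp_all add: mem_neighbors)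
  with edge_imp_vertices[OF simple]
  have "card {x, y, z} = 3" "clique {x, y, z} E" "{x, y, z} \<subseteq> V"
    by (auto simp: clique_def card_insert_if insert_commute)
  then show False
    using no_triangle by (auto simp: triangle_free_def)
qed

section \<open>Double counting of degrees and codegrees\<close>

lemma sum_over_neighbors:
  fixes f :: "'a \<Rightarrow> int"
  shows "(\<Sum>v\<in>V. \<Sum>y\<in>N v. f y) = (\<Sum>y\<in>V. d y * f y)"
proof -
  have "(\<Sum>v\<in>V. \<Sum>y\<in>N v. f y) = (\<Sum>v\<in>V. \<Sum>y\<in>{y. y \<in> V \<and> {y, v} \<in> E}. f y)"
    by (simp add: neighbors_def)
  also have "\<dots> = (\<Sum>y\<in>V. \<Sum>v\<in>{v. v \<in> V \<and> {y, v} \<in> E}. f y)"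
    by (rule sum.swap_restrict) simp_all
  also have "\<dots> = (\<Sum>y\<in>V. d y * f y)"
    by (intro sum.cong) (simp_all add: neighbors_def insert_commute)
  finally show ?thesis .
qed

text \<open>Both sides count the paths \<open>v\<close>, \<open>y\<close>, \<open>w\<close> with two
  edges: without triangles, such a \<open>w\<close> is never adjacent to \<open>v\<close>.\<close>

lemma sum_codeg:
  assumes v: "v \<in> V"
  shows "(\<Sum>w\<in>W v. c v w) = (\<Sum>y\<in>N v. d y - 1)"
proof -
  have "(\<Sum>w\<in>W v. c v w) = (\<Sum>w\<in>W v. \<Sum>y\<in>{y. y \<in> N v \<and> y \<in> N w}. 1)"
    by (simp add: codeg_def Int_def)
  also have "\<dots> = (\<Sum>y\<in>N v. \<Sum>w\<in>{w. w \<in> W v \<and> y \<in> N w}. 1)"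
    by (rule sum.swap_restrict) simp_all
  also have "\<dots> = (\<Sum>y\<in>N v. d y - 1)"
  proof (rule sum.cong[OF refl])
    fix y assume y: "y \<in> N v"
    then have "{w. w \<in> W v \<and> y \<in> N w} = N y - {v}"
      using neighbors_sym triangleD neighbors_subset by blast
    moreover have "v \<in> N y"
      using y neighbors_sym by blast
    then have "int (card (N y - {v})) = d y - 1"
      using card_Suc_Diff1[of "N y" v] by simp
    ultimately show "(\<Sum>w\<in>{w. w \<in> W v \<and> y \<in> N w}. 1) = d y - 1"
      by simp
  qed
  finally show ?thesis .
qed

text \<open>Identifies \<open>d w - c v w\<close> as the degree of \<open>w\<close> in the subgraph
  induced on \<open>W v\<close>.\<close>

lemma card_neighbors_split:
  assumes "w \<in> W v"
  shows "int (card (N w \<inter> W v)) = d w - c v w"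
proof -
  have "N w = (N w \<inter> W v) \<union> (N v \<inter> N w)"
    using assms neighbors_subset neighbors_sym by blast
  moreover have "card ((N w \<inter> W v) \<union> (N v \<inter> N w)) = card (N w \<inter> W v) + card (N v \<inter> N w)"
    by (rule card_Un_disjoint) auto
  ultimately show ?thesis
    by (simp add: codeg_def)
qed

text \<open>Adjacent vertices have disjoint neighbourhoods, so their traces on \<open>N v\<close>
  are disjoint.\<close>

lemma codeg_edge_le:
  assumes "w \<in> N w'"
  shows "c v w + c v w' \<le> d v"
proof -
  have "card (N v \<inter> N w) + card (N v \<inter> N w') = card ((N v \<inter> N w) \<union> (N v \<inter> N w'))"
  proof (rule card_Un_disjoint[symmetric])
    show "N v \<inter> N w \<inter> (N v \<inter> N w') = {}"
      using assms triangleD neighbors_sym by blast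
  qed simp_all
  also have "\<dots> \<le> card (N v)"
    by (rule card_mono) auto
  finally show ?thesis
    by (simp add: codeg_def)
qed

text \<open>This is \<open>codeg_edge_le\<close> summed over the ordered adjacent pairs inside
  \<open>W v\<close>; by symmetry both endpoints contribute the same sum, hence the factor
  2.\<close>

lemma sum_codeg_edges:
  "2 * (\<Sum>w\<in>W v. c v w * (d w - c v w)) \<le> d v * (\<Sum>w\<in>W v. d w - c v w)"
proof -
  let ?R = "\<lambda>w w'. w' \<in> N w"
  have eq: "(\<Sum>w\<in>W v. f w * (d w - c v w)) = (\<Sum>w\<in>W v. \<Sum>w'\<in>{w'. w' \<in> W v \<and> ?R w w'}. f w)"
    for f :: "'a \<Rightarrow> int"
  proof (rule sum.cong[OF refl])
    fix w assume w: "w \<in> W v"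
    have "{w'. w' \<in> W v \<and> ?R w w'} = N w \<inter> W v"
      by blast
    then show "f w * (d w - c v w) = (\<Sum>w'\<in>{w'. w' \<in> W v \<and> ?R w w'}. f w)"
      using card_neighbors_split[OF w] by simp
  qed
  have sw: "(\<Sum>w\<in>W v. \<Sum>w'\<in>{w'. w' \<in> W v \<and> ?R w w'}. c v w)
      = (\<Sum>w\<in>W v. \<Sum>w'\<in>{w'. w' \<in> W v \<and> ?R w w'}. c v w')"
  proof -
    have "(\<Sum>w\<in>W v. \<Sum>w'\<in>{w'. w' \<in> W v \<and> ?R w w'}. c v w)
      = (\<Sum>w'\<in>W v. \<Sum>w\<in>{w. w \<in> W v \<and> ?R w w'}. c v w)"
      by (rule sum.swap_restrict) simp_all
    then show ?thesis
      using neighbors_sym by simp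
  qed
  have "2 * (\<Sum>w\<in>W v. c v w * (d w - c v w))
      = (\<Sum>w\<in>W v. \<Sum>w'\<in>{w'. w' \<in> W v \<and> ?R w w'}. c v w + c v w')"
    unfolding eq sum.distrib using sw by simp
  also have "\<dots> \<le> (\<Sum>w\<in>W v. \<Sum>w'\<in>{w'. w' \<in> W v \<and> ?R w w'}. d v)"
    using codeg_edge_le neighbors_sym by (intro sum_mono) auto
  also have "\<dots> = d v * (\<Sum>w\<in>W v. d w - c v w)"
    using eq[of "\<lambda>_. d v"] by (simp add: sum_distrib_left)
  finally show ?thesis .
qed

lemma sum_split_neighbors:
  fixes f :: "'a \<Rightarrow> int"
  assumes "v \<in> V"
  shows "(\<Sum>w\<in>W v. f w) = (\<Sum>w\<in>V. f w) - f v - (\<Sum>y\<in>N v. f y)"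
proof -
  have "(\<Sum>w\<in>W v. f w) = (\<Sum>w\<in>V. f w) - (\<Sum>w\<in>insert v (N v). f w)"
    using assms neighbors_subset by (intro sum_diff) auto
  then show ?thesis
    by simp
qed

lemma card_nonneighbors:
  assumes "v \<in> V"
  shows "int (card (W v)) = int (card V) - 1 - d v"
  using sum_split_neighbors[OF assms, of "\<lambda>_. 1"] by simp

section \<open>A pair with small closed neighbourhoods, by counting\<close>

lemma exists_pair_small_closed_neighborhood:
  assumes V2: "card V \<ge> 2"
  shows "\<exists>v\<in>V. \<exists>w\<in>V. v \<noteq> w \<and> 2 * card (N v \<union> N w \<union> {v, w}) \<le> card V + 4"
proof (rule ccontr)
  assume "\<not> ?thesis"
  then have large: "2 * card (N v \<union> N w \<union> {v, w}) > card V + 4"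
    if "v \<in> V" "w \<in> V" "v \<noteq> w" for v w
    using that by (meson not_le)
  define n where "n = int (card V)"
  \<comment> \<open>The points \<open>v, w\<close> account for the 4 in \<open>large\<close>;
    integrality turns the strict inequality into the final \<open>- 1\<close>.\<close>
  have nonadj: "2 * c v w \<le> 2 * d v + 2 * d w - n - 1" if "v \<in> V" "w \<in> W v" for v w
  proof -
    have "card (N v \<union> N w \<union> {v, w}) \<le> card (N v \<union> N w) + card {v, w}"
      by (rule card_Un_le)
    also have "\<dots> \<le> card (N v \<union> N w) + 2"
      by (simp add: card_insert_if)
    finally have "2 * (card (N v \<union> N w) + 2) > card V + 4"
      using large[of v w] that by auto
    moreover have "card (N v) + card (N w) = card (N v \<union> N w) + card (N v \<inter> N w)"
      by (rule card_Un_Int) simp_all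
    ultimately have "2 * card (N v \<inter> N w) + card V + 1 \<le> 2 * card (N v) + 2 * card (N w)"
      by presburger
    then have "int (2 * card (N v \<inter> N w) + card V + 1) \<le> int (2 * card (N v) + 2 * card (N w))"
      by (simp only: of_nat_le_iff)
    then show ?thesis
      by (simp add: codeg_def n_def)
  qed
  \<comment> \<open>Adjacent \<open>v, w\<close> already lie in \<open>N v \<union> N w\<close>, so
    nothing is lost to them and the bound is stronger.\<close>
  have adj: "2 * (d v + d w) \<ge> n + 5" if "w \<in> N v" for v w
  proof -
    have "N v \<union> N w \<union> {v, w} = N v \<union> N w"
      using that neighbors_sym by blast
    moreover have "card (N v \<union> N w) \<le> card (N v) + card (N w)"
      by (rule card_Un_le)
    moreover have "v \<in> V" "w \<in> V" "v \<noteq> w"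
      using that neighbors_subset neighbors_sym neighbors_irrefl by blast+
    ultimately show ?thesis
      using large[of v w] unfolding n_def by simp
  qed
  have n5: "n \<ge> 5"
  proof -
    obtain v w where vw: "v \<in> V" "w \<in> V" "v \<noteq> w"
      using V2 by (metis card_le_Suc0_iff_eq finite_V not_less_eq_eq numeral_2_eq_2)
    then have "card (N v \<union> N w \<union> {v, w}) \<le> card V"
      using neighbors_subset by (intro card_mono) auto
    then show ?thesis
      using large[OF vw] unfolding n_def by simp
  qed
  define P where "P = (\<Sum>v\<in>V. d v)"
  define Q where "Q = (\<Sum>v\<in>V. d v * d v)"
  \<comment> \<open>\<open>S v\<close> is the number of walks of length 2 from \<open>v\<close>, and
    \<open>Q\<close> is the number of all such walks.\<close>
  define S where "S v = (\<Sum>y\<in>N v. d y)" for v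
  have sum_S: "(\<Sum>v\<in>V. S v) = Q"
    unfolding S_def Q_def by (rule sum_over_neighbors)
  have sum_c: "(\<Sum>w\<in>W v. c v w) = S v - d v" if "v \<in> V" for v
    using sum_codeg[OF that] by (simp add: S_def sum_subtractf)
  have sum_d: "(\<Sum>w\<in>W v. d w) = P - d v - S v" if "v \<in> V" for v
    using sum_split_neighbors[OF that, of d] by (simp add: S_def P_def)
  have mean_codeg: "4 * S v \<le> 2 * P - 2 * (d v * d v) + (3 * n - 1) * d v - (n * n - 1)"
    if v: "v \<in> V" for v
  proof -
    have "2 * (S v - d v) = (\<Sum>w\<in>W v. 2 * c v w)"
      by (simp add: sum_c[OF v, symmetric] sum_distrib_left)
    also have "\<dots> \<le> (\<Sum>w\<in>W v. (2 * d v - n - 1) + 2 * d w)"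
      using nonadj[OF v] by (intro sum_mono) (simp add: algebra_simps)
    also have "\<dots> = int (card (W v)) * (2 * d v - n - 1) + 2 * (\<Sum>w\<in>W v. d w)"
      by (simp only: sum.distrib sum_constant sum_distrib_left)
    also have "\<dots> = (n - 1 - d v) * (2 * d v - n - 1) + 2 * (P - d v - S v)"
      by (simp only: card_nonneighbors[OF v] sum_d[OF v] n_def)
    finally show ?thesis
      by (simp add: algebra_simps)
  qed
  \<comment> \<open>Rearranged, \<open>nonadj\<close> bounds the degree of \<open>w\<close> within
    \<open>W v\<close> from below by \<open>(n + 1)/2 - d v\<close>. Weighting this by
    \<open>c v w\<close> allows a comparison with \<open>sum_codeg_edges\<close>.\<close>
  have edge_codeg: "(n + 1) * S v \<le> P * d v + (n + 1) * d v - 2 * (d v * d v)"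
    if v: "v \<in> V" for v
  proof -
    have "(n + 1 - 2 * d v) * (S v - d v) = (\<Sum>w\<in>W v. c v w * (n + 1 - 2 * d v))"
      unfolding sum_c[OF v, symmetric] sum_distrib_left by (simp only: mult.commute)
    also have "\<dots> \<le> (\<Sum>w\<in>W v. 2 * (c v w * (d w - c v w)))"
    proof (rule sum_mono)
      fix w assume "w \<in> W v"
      from nonadj[OF v this] have "c v w * (n + 1 - 2 * d v) \<le> c v w * (2 * (d w - c v w))"
        by (intro mult_left_mono) auto
      then show "c v w * (n + 1 - 2 * d v) \<le> 2 * (c v w * (d w - c v w))"
        by (simp only: mult.left_commute)
    qed
    also have "\<dots> \<le> d v * (\<Sum>w\<in>W v. d w - c v w)"
      using sum_codeg_edges[of v] by (simp only: sum_distrib_left)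
    also have "\<dots> = d v * ((P - d v - S v) - (S v - d v))"
      by (simp only: sum_subtractf sum_c[OF v] sum_d[OF v])
    finally show ?thesis
      by (simp add: algebra_simps)
  qed
  have A: "6 * Q \<le> (5 * n - 1) * P - n * (n * n - 1)"
  proof -
    have "(\<Sum>v\<in>V. 4 * S v)
        \<le> (\<Sum>v\<in>V. 2 * P - 2 * (d v * d v) + (3 * n - 1) * d v - (n * n - 1))"
      by (intro sum_mono mean_codeg)
    also have "\<dots> = n * (2 * P) - 2 * Q + (3 * n - 1) * P - n * (n * n - 1)"
      by (simp only: sum.distrib sum_subtractf sum_constant sum_distrib_left[symmetric]
          n_def Q_def[symmetric] P_def[symmetric]) (simp add: algebra_simps)
    finally show ?thesis
      unfolding sum_distrib_left[symmetric] sum_S by (simp add: algebra_simps)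
  qed
  have B: "(n + 3) * Q \<le> P * P + (n + 1) * P"
  proof -
    have "(\<Sum>v\<in>V. (n + 1) * S v) \<le> (\<Sum>v\<in>V. P * d v + (n + 1) * d v - 2 * (d v * d v))"
      by (intro sum_mono edge_codeg)
    also have "\<dots> = P * P + (n + 1) * P - 2 * Q"
      by (simp only: sum.distrib sum_subtractf sum_distrib_left[symmetric]
          Q_def[symmetric] P_def[symmetric])
    finally show ?thesis
      unfolding sum_distrib_left[symmetric] sum_S by (simp add: algebra_simps)
  qed
  \<comment> \<open>The deviations from the mean degree are scaled by \<open>n\<close> to remain
    integers. Nonnegativity gives Cauchy-Schwarz; vanishing will give regularity.\<close>
  have variance: "(\<Sum>v\<in>V. (n * d v - P)\<^sup>2) = n * (n * Q - P * P)"
  proof -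
    have "(\<Sum>v\<in>V. (n * d v - P)\<^sup>2) = (\<Sum>v\<in>V. n * n * (d v * d v) - 2 * n * P * d v + P * P)"
      by (intro sum.cong) (simp_all add: power2_eq_square algebra_simps)
    also have "\<dots> = n * n * Q - 2 * n * P * P + n * (P * P)"
      by (simp only: sum.distrib sum_subtractf sum_constant sum_distrib_left[symmetric]
          n_def Q_def[symmetric] P_def[symmetric])
    finally show ?thesis
      by (simp add: algebra_simps)
  qed
  have CS: "P * P \<le> n * Q"
  proof -
    have "0 \<le> n * (n * Q - P * P)"
      unfolding variance[symmetric] by (intro sum_nonneg) simp
    then show ?thesis
      using n5 by (simp add: zero_le_mult_iff)
  qed
  \<comment> \<open>By \<open>A\<close> and \<open>CS\<close>, a quadratic in \<open>P\<close> with
    roots \<open>n(n + 1)/3\<close> and \<open>n(n - 1)/2\<close> is at most 0. For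
    \<open>n \<ge> 5\<close> the first root is the smaller one, and \<open>P\<close> cannot lie
    below both.\<close>
  have lower: "n * (n + 1) \<le> 3 * P"
  proof (rule ccontr)
    assume "\<not> ?thesis"
    then have less: "3 * P < n * (n + 1)"
      by simp
    moreover have "2 * (n * (n + 1)) \<le> 3 * (n * (n - 1))"
    proof -
      have "5 * n \<le> n * n"
        using n5 by (intro mult_right_mono) auto
      then show ?thesis
        by (simp add: algebra_simps)
    qed
    ultimately have "2 * P < n * (n - 1)"
      by linarith
    with less have "0 < (n * (n + 1) - 3 * P) * (n * (n - 1) - 2 * P)"
      by (intro mult_pos_pos) auto
    also have "\<dots> = 6 * (P * P) - n * ((5 * n - 1) * P - n * (n * n - 1))"
      by (simp add: algebra_simps)
    also have "\<dots> \<le> 6 * (P * P) - n * (6 * Q)"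
      using mult_left_mono[OF A, of n] n5 by linarith
    also have "\<dots> \<le> 0"
      using CS by simp
    finally show False
      by simp
  qed
  have "0 < n * (n + 1)"
    using n5 by simp
  then have P0: "P > 0"
    using lower by linarith
  \<comment> \<open>Combined with \<open>lower\<close>, this is the reverse of \<open>CS\<close>, so
    equality holds there and then in \<open>lower\<close> too.\<close>
  have B': "(n + 3) * (n * Q) \<le> n * (P * P) + P * (n * (n + 1))"
    using mult_left_mono[OF B, of n] n5 by (simp add: algebra_simps)
  also have "\<dots> \<le> n * (P * P) + P * (3 * P)"
    using lower P0 by (intro add_left_mono mult_left_mono) auto
  also have "\<dots> = (n + 3) * (P * P)"
    by (simp add: algebra_simps)
  finally have "n * Q \<le> P * P"
    using n5 by simp
  with CS have CS_eq: "n * Q = P * P"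
    by simp
  have P3: "3 * P = n * (n + 1)"
  proof -
    have "P * (3 * P) \<le> P * (n * (n + 1))"
      using B' unfolding CS_eq by (simp add: algebra_simps)
    then show ?thesis
      using P0 lower by simp
  qed
  have regular: "3 * d v = n + 1" if "v \<in> V" for v
  proof -
    have "(\<Sum>v\<in>V. (n * d v - P)\<^sup>2) = 0"
      by (simp add: variance CS_eq)
    then have "n * d v = P"
      using that by (simp add: sum_nonneg_eq_0_iff)
    then have "n * (3 * d v) = n * (n + 1)"
      using P3 by (simp only: mult.left_commute)
    then show ?thesis
      using n5 by simp
  qed
  obtain v where v: "v \<in> V"
    using V2 by fastforce
  \<comment> \<open>With \<open>n + 1 = 3d\<close>, \<open>nonadj\<close> reads
    \<open>2c \<le> d\<close>. Since \<open>W x\<close> has \<open>2d - 2\<close> elements and the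
    values \<open>2c\<close> sum to \<open>(2d - 2)d\<close>, every one of these inequalities is
    tight.\<close>
  have half: "2 * c x w = d x" if x: "x \<in> V" and w: "w \<in> W x" for x w
  proof -
    have le: "2 * c x u \<le> d x" if "u \<in> W x" for u
      using nonadj[OF x that] regular[OF x] regular[of u] that by auto
    have "S x = d x * d x"
    proof -
      have "S x = (\<Sum>y\<in>N x. d x)"
        unfolding S_def using regular regular[OF x] neighbors_subset
        by (intro sum.cong) fastforce+
      then show ?thesis by simp
    qed
    then have "(\<Sum>u\<in>W x. 2 * c x u) = (2 * d x - 2) * d x"
      by (simp add: sum_distrib_left[symmetric] sum_c[OF x] algebra_simps)
    also have "2 * d x - 2 = int (card (W x))"
      using regular[OF x] by (simp add: card_nonneighbors[OF x] n_def)
    finally have "(\<Sum>u\<in>W x. 2 * c x u) = (\<Sum>u\<in>W x. d x)"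
      by simp
    then have "(\<Sum>u\<in>W x. d x - 2 * c x u) = 0"
      by (simp add: sum_subtractf)
    then have "\<forall>u\<in>W x. d x - 2 * c x u = 0"
      using le by (subst (asm) sum_nonneg_eq_0_iff) auto
    then show ?thesis
      using w by simp
  qed
  \<comment> \<open>For an edge, \<open>adj\<close> reads
    \<open>4d \<ge> n + 5 = 3d + 4\<close>.\<close>
  have d4: "d v \<ge> 4"
  proof -
    have "d v > 0"
      using regular[OF v] n5 by linarith
    then obtain y where y: "y \<in> N v"
      by (auto simp: card_gt_0_iff)
    then have "y \<in> V"
      using neighbors_subset by blast
    then show ?thesis
      using adj[OF y] regular[OF v] regular[of y] by simp
  qed
  have "int (card (W v)) > 0"
    using card_nonneighbors[OF v] regular[OF v] d4 by (simp add: n_def)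
  then obtain w where w: "w \<in> W v"
    by (auto simp: card_gt_0_iff)
  \<comment> \<open>The cardinality is \<open>d - d/2\<close>, so \<open>d \<ge> 4\<close> is
    exactly what provides two vertices.\<close>
  have "2 \<le> card (N w \<inter> W v)"
    using card_neighbors_split[OF w] half[OF v w] regular[OF v] regular[of w] w d4 by auto
  then obtain x y where xy: "x \<in> N w \<inter> W v" "y \<in> N w \<inter> W v" "x \<noteq> y"
    by (metis card_le_Suc0_iff_eq finite_Int finite_neighbors not_less_eq_eq numeral_2_eq_2)
  \<comment> \<open>The neighbours in \<open>N v\<close> of any neighbour of \<open>w\<close> are exactly the half of \<open>N v\<close> missed
    by \<open>w\<close>, so \<open>x\<close> and \<open>y\<close> share these as well as \<open>w\<close>.\<close>
  have other_half: "N v \<inter> N u = N v - N w" if "u \<in> N w \<inter> W v" for u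
  proof (rule card_subset_eq)
    show "N v \<inter> N u \<subseteq> N v - N w"
      using that triangleD neighbors_sym by blast
    have "card (N v - N w) = card (N v) - card (N v \<inter> N w)"
      by (simp add: card_Diff_subset_Int)
    then show "card (N v \<inter> N u) = card (N v - N w)"
      using half[OF v w] half[OF v, of u] that unfolding codeg_def by auto
  qed simp
  have "y \<in> W x"
    using xy triangleD by blast
  moreover have "x \<in> V"
    using xy by blast
  ultimately have "2 * c x y = d v"
    using half[of x y] regular[of x] regular[OF v] by auto
  moreover have "insert w (N v \<inter> N x) \<subseteq> N x \<inter> N y"
    using xy other_half[of x] other_half[of y] neighbors_sym by blast
  then have "card (insert w (N v \<inter> N x)) \<le> card (N x \<inter> N y)"
    by (intro card_mono) auto
  then have "c x y \<ge> c v x + 1"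
    using w neighbors_sym by (auto simp: codeg_def card_insert_if)
  moreover have "2 * c v x = d v"
    using half[OF v, of x] xy by blast
  ultimately show False
    by linarith
qed

section \<open>Maximum matchings and clique covers\<close>

definition matching :: "'a set set \<Rightarrow> bool" where
  "matching M \<longleftrightarrow> M \<subseteq> E \<and> disjoint M"

lemma finite_E: "finite E"
proof (rule finite_subset)
  show "E \<subseteq> Pow V"
    using simple by (auto simp: finite_simple_graph_def nsets_def)
qed simp

lemma card_edge: "e \<in> E \<Longrightarrow> card e = 2" and edge_subset: "e \<in> E \<Longrightarrow> e \<subseteq> V"
  using simple by (auto simp: finite_simple_graph_def nsets_def)

lemma card_Union_matching:
  assumes "matching M"
  shows "card (\<Union>M) = 2 * card M"
proof -
  have "card (\<Union>M) = (\<Sum>e\<in>M. card e)"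
    using assms card_edge by (intro card_Union_disjoint)
      (auto simp: matching_def subset_iff intro: card_ge_0_finite)
  also have "\<dots> = (\<Sum>e\<in>M. 2)"
    using assms card_edge by (intro sum.cong) (auto simp: matching_def)
  finally show ?thesis
    by simp
qed

lemma exists_maximum_matching:
  "\<exists>M. matching M \<and> (\<forall>M'. matching M' \<longrightarrow> card M' \<le> card M)"
  using ex_has_greatest_nat[of matching "{}" card "Suc (card E)"]
    card_mono[OF finite_E] by (auto simp: matching_def less_Suc_eq_le)

text \<open>The edges of \<open>M\<close> and the unmatched singletons form a cover by
  \<open>|M| + (n - 2|M|)\<close> cliques.\<close>

lemma clique_cover_number_le_matching:
  assumes "matching M"
  shows "clique_cover_number V E + card M \<le> card V"
proof -
  let ?U = "V - \<Union>M"
  let ?C = "M \<union> (\<lambda>u. {u}) ` ?U"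
  have sub: "\<Union>M \<subseteq> V"
    using assms edge_subset by (auto simp: matching_def)
  have fin: "finite M"
    using assms finite_E by (auto simp: matching_def intro: finite_subset)
  have "clique K E" if "K \<in> M" for K
  proof -
    have "K \<in> E"
      using assms that by (auto simp: matching_def)
    moreover from this obtain x y where "K = {x, y}"
      using card_edge by (meson card_2_iff)
    ultimately show ?thesis
      by (auto simp: clique_def insert_commute)
  qed
  then have "clique_cover V E ?C"
    using sub by (auto simp: clique_cover_def clique_def)
  then have "clique_cover_number V E \<le> card ?C"
    unfolding clique_cover_number_def using fin by (intro Least_le exI[of _ ?C]) auto
  also have "\<dots> \<le> card M + card ?U"
    by (meson card_Un_le card_image_le finite_Diff finite_V add_left_mono le_trans)
  finally have "clique_cover_number V E \<le> card M + card ?U" .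
  moreover have "card ?U = card V - 2 * card M" "2 * card M \<le> card V"
    using sub card_Union_matching[OF assms] card_mono[OF finite_V sub]
    by (simp_all add: card_Diff_subset finite_subset)
  ultimately show ?thesis
    by simp
qed

lemma matching_insert:
  assumes "matching M" "{x, y} \<in> E" "x \<notin> \<Union>M" "y \<notin> \<Union>M"
  shows "matching (insert {x, y} M)" "card (insert {x, y} M) = Suc (card M)"
proof -
  show "matching (insert {x, y} M)"
    using assms by (auto simp: matching_def pairwise_insert disjnt_def)
  have "finite M"
    using assms(1) finite_E by (auto simp: matching_def intro: finite_subset)
  moreover have "{x, y} \<notin> M"
    using assms by blast
  ultimately show "card (insert {x, y} M) = Suc (card M)"
    by simp
qed

text \<open>Sending each vertex of the union to its matching edge is injective: two ends of one edge
  would give a triangle or an augmenting path.\<close>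

lemma neighbors_of_unmatched:
  assumes M: "matching M" and max: "\<And>M'. matching M' \<Longrightarrow> card M' \<le> card M"
    and u: "u \<in> V - \<Union>M" "u' \<in> V - \<Union>M" "u \<noteq> u'"
  shows "card (N u \<union> N u') \<le> card M"
proof -
  \<comment> \<open>An uncovered neighbour of an unmatched vertex would yield an edge extending
    \<open>M\<close>.\<close>
  have covered: "x \<in> \<Union>M" if xN: "x \<in> N u \<union> N u'" for x
  proof (rule ccontr)
    assume x: "x \<notin> \<Union>M"
    obtain z where z: "{x, z} \<in> E" "z \<notin> \<Union>M"
      using xN u by (auto simp: mem_neighbors)
    show False
      using max[OF matching_insert(1)[OF M z(1) x z(2)]] matching_insert(2)[OF M z(1) x z(2)]
      by simp
  qed
  define e where "e x = (SOME e. e \<in> M \<and> x \<in> e)" for x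
  have e: "e x \<in> M" "x \<in> e x" if "x \<in> N u \<union> N u'" for x
    using someI_ex[of "\<lambda>e. e \<in> M \<and> x \<in> e"] covered[OF that] by (auto simp: e_def)
  \<comment> \<open>On the augmenting path \<open>s, x, y, t\<close>, the edge \<open>{x, y}\<close>
    is exchanged for \<open>{x, s}\<close> and \<open>{y, t}\<close>.\<close>
  have no_augment: False
    if x: "x \<in> N s" and y: "y \<in> N t" and xy: "{x, y} \<in> M" "x \<noteq> y"
      and st: "s \<in> V - \<Union>M" "t \<in> V - \<Union>M" "s \<noteq> t" for x y s t
  proof -
    let ?M = "M - {{x, y}}"
    have M0: "matching ?M"
      using M by (auto simp: matching_def pairwise_def)
    have "disjnt e {x, y}" if "e \<in> ?M" for e
      using M xy(1) that by (auto simp: matching_def simp del: disjnt_insert2 intro: pairwiseD)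
    then have out: "x \<notin> \<Union>?M" "y \<notin> \<Union>?M" "s \<notin> \<Union>?M" "t \<notin> \<Union>?M"
      using st by (auto simp: disjnt_def)
    have neq: "s \<noteq> x" "s \<noteq> y" "t \<noteq> x" "t \<noteq> y"
      using xy st by auto
    have E: "{x, s} \<in> E" "{y, t} \<in> E"
      using x y by (simp_all add: mem_neighbors)
    note M1 = matching_insert[OF M0 E(1) out(1,3)]
    have "y \<notin> \<Union>(insert {x, s} ?M)" "t \<notin> \<Union>(insert {x, s} ?M)"
      using out neq xy st by auto
    note M2 = matching_insert[OF M1(1) E(2) this]
    have "finite M"
      using M finite_E by (auto simp: matching_def intro: finite_subset)
    then have "Suc (card ?M) = card M"
      using xy by (intro card_Suc_Diff1)
    then show False
      using max[OF M2(1)] M2(2) M1(2) by simp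
  qed
  have "inj_on e (N u \<union> N u')"
  proof (rule inj_onI, rule ccontr)
    fix x y assume x: "x \<in> N u \<union> N u'" and y: "y \<in> N u \<union> N u'" and eq: "e x = e y" and neq: "x \<noteq> y"
    have "e x \<in> E"
      using e(1)[OF x] M by (auto simp: matching_def)
    then have "e x = {x, y}"
      using card_edge e(2)[OF x] e(2)[OF y] eq neq
      by (intro card_subset_eq[symmetric]) (auto intro: card_ge_0_finite)
    then have xy: "{x, y} \<in> M" "{x, y} \<in> E"
      using e(1)[OF x] \<open>e x \<in> E\<close> by simp_all
    then have "x \<in> N y"
      by (simp add: mem_neighbors)
    then have "x \<in> N u \<and> y \<in> N u' \<or> x \<in> N u' \<and> y \<in> N u"
      using x y triangleD by blast
    then show False
      using no_augment[OF _ _ xy(1) neq] u by blast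
  qed
  moreover have "e ` (N u \<union> N u') \<subseteq> M"
    using e(1) by blast
  moreover have "finite M"
    using M finite_E by (auto simp: matching_def intro: finite_subset)
  ultimately show ?thesis
    by (rule card_inj_on_le)
qed

lemma card_le_closed_neighborhoods_add_max_anti_codeg:
  assumes "v \<in> V" "w \<in> V" "v \<noteq> w"
  shows "card V \<le> card (N v \<union> N w \<union> {v, w}) + max_anti_codeg V E"
proof -
  have "{anti_codeg V E v w | v w. v \<in> V \<and> w \<in> V \<and> v \<noteq> w}
      \<subseteq> (\<lambda>(v, w). anti_codeg V E v w) ` (V \<times> V)"
    by auto
  then have "finite {anti_codeg V E v w | v w. v \<in> V \<and> w \<in> V \<and> v \<noteq> w}"
    by (rule finite_subset) simp
  then have "anti_codeg V E v w \<le> max_anti_codeg V E"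
    unfolding max_anti_codeg_def using assms by (intro Max_ge) auto
  moreover have "N v \<union> N w \<union> {v, w} \<subseteq> V"
    using assms neighbors_subset by blast
  then have "card (N v \<union> N w \<union> {v, w}) + anti_codeg V E v w = card V"
    unfolding anti_codeg_def
    by (metis card_mono card_Diff_subset finite_V finite_subset le_add_diff_inverse)
  ultimately show ?thesis
    by linarith
qed

theorem clique_cover_number_le: "clique_cover_number V E \<le> max_anti_codeg V E + 2"
proof -
  obtain M where M: "matching M" and max: "\<And>M'. matching M' \<Longrightarrow> card M' \<le> card M"
    using exists_maximum_matching by blast
  note cover = clique_cover_number_le_matching[OF M]
  let ?U = "V - \<Union>M"
  have sub: "\<Union>M \<subseteq> V"
    using M edge_subset by (auto simp: matching_def)
  have card_V: "card V = 2 * card M + card ?U"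
    using sub card_Union_matching[OF M] card_mono[OF finite_V sub]
    by (simp add: card_Diff_subset finite_subset)
  consider "card V \<le> 1" | "card V \<ge> 2" "card ?U \<le> 1" | "card ?U \<ge> 2"
    by linarith
  then show ?thesis
  proof cases
    case 1
    then show ?thesis
      using cover by linarith
  next
    case 2
    then obtain v w where "v \<in> V" "w \<in> V" "v \<noteq> w"
      and "2 * card (N v \<union> N w \<union> {v, w}) \<le> card V + 4"
      using exists_pair_small_closed_neighborhood by blast
    \<comment> \<open>Twice the cover number is at most \<open>n + 1\<close>, while twice the target
      is at least \<open>n\<close>; integrality absorbs the difference of 1.\<close>
    with card_le_closed_neighborhoods_add_max_anti_codeg[of v w] show ?thesis
      using cover card_V 2 by linarith
  next
    case 3
    then obtain u u' where u: "u \<in> ?U" "u' \<in> ?U" "u \<noteq> u'"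
      by (metis card_le_Suc0_iff_eq finite_Diff finite_V not_less_eq_eq numeral_2_eq_2)
    have "card (N u \<union> N u' \<union> {u, u'}) \<le> card (N u \<union> N u') + card {u, u'}"
      by (rule card_Un_le)
    also have "\<dots> \<le> card M + 2"
      using neighbors_of_unmatched[OF M max u] u(3) by simp
    finally show ?thesis
      using card_le_closed_neighborhoods_add_max_anti_codeg[of u u'] u cover by auto
  qed
qed

end

section \<open>Passage to the complement\<close>

lemma triangle_free_complement:
  assumes "finite_simple_graph V E" "independence_number V E \<le> 2"
  shows "triangle_free V ([V]\<^bsup>2\<^esup> - E)"
  unfolding triangle_free_def
proof
  assume "\<exists>T. T \<subseteq> V \<and> card T = 3 \<and> clique T ([V]\<^bsup>2\<^esup> - E)"
  then obtain T where T: "T \<subseteq> V" "card T = 3" "indep T E"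
    by (auto simp: clique_def indep_def)
  have "{card S | S. S \<subseteq> V \<and> indep S E} \<subseteq> card ` Pow V"
    by auto
  then have "finite {card S | S. S \<subseteq> V \<and> indep S E}"
    using assms(1) by (auto simp: finite_simple_graph_def intro: finite_subset)
  then have "card T \<le> independence_number V E"
    unfolding independence_number_def using T by (intro Max_ge) auto
  then show False
    using T assms(2) by simp
qed

text \<open>Each vertex is coloured by the index of one chosen clique containing it, as the cliques
  of a cover may overlap. Cliques of the complement contain no edge of \<open>E\<close>.\<close>

lemma chromatic_number_le_clique_cover_number_complement:
  assumes simple: "finite_simple_graph V E"
  shows "chromatic_number V E \<le> clique_cover_number V ([V]\<^bsup>2\<^esup> - E)"
proof -
  let ?E = "[V]\<^bsup>2\<^esup> - E"
  \<comment> \<open>The singletons form a finite cover, so the minimum in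
    \<open>clique_cover_number\<close> is attained.\<close>
  have "finite ((\<lambda>v. {v}) ` V) \<and> clique_cover V ?E ((\<lambda>v. {v}) ` V)"
    using simple by (auto simp: clique_cover_def clique_def finite_simple_graph_def)
  then have "\<exists>k C. finite C \<and> card C = k \<and> clique_cover V ?E C"
    by blast
  then have "\<exists>C. finite C \<and> card C = clique_cover_number V ?E \<and> clique_cover V ?E C"
    unfolding clique_cover_number_def by (rule LeastI_ex)
  then obtain C where C: "finite C" "card C = clique_cover_number V ?E" "clique_cover V ?E C"
    by blast
  obtain g where g: "bij_betw g C {..<card C}"
    using C(1) ex_bij_betw_finite_nat[of C] by (auto simp: atLeast0LessThan)
  define K where "K v = (SOME K. K \<in> C \<and> v \<in> K)" for v
  have K: "K v \<in> C" "v \<in> K v" if "v \<in> V" for v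
    using someI_ex[of "\<lambda>K. K \<in> C \<and> v \<in> K"] C(3) that by (auto simp: K_def clique_cover_def)
  have "(g \<circ> K) ` V \<subseteq> {..<card C}"
    using K(1) g by (auto simp: bij_betw_def)
  moreover have "proper_coloring V E (g \<circ> K)"
    unfolding proper_coloring_def
  proof (intro ballI impI notI)
    fix u v assume uv: "u \<in> V" "v \<in> V" "{u, v} \<in> E" and "(g \<circ> K) u = (g \<circ> K) v"
    then have "K u = K v"
      using g K(1) by (auto simp: bij_betw_def dest: inj_onD)
    then have "{u, v} \<in> ?E"
      using C(3) K uv edge_imp_vertices(3)[OF simple uv(3)]
      by (metis clique_cover_def clique_def)
    then show False
      using uv(3) by simp
  qed
  ultimately show ?thesis
    unfolding chromatic_number_def C(2) by (intro Least_le) blast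
qed

theorem theorem5p3:
  shows "(\<forall>(V :: 'a set) E. finite_simple_graph V E \<and> independence_number V E \<le> 2 \<longrightarrow>
            chromatic_number V E \<le> max_codeg V E + 2) \<and>
         (\<forall>(V :: 'a set) E. finite_simple_graph V E \<and> triangle_free V E \<longrightarrow>
            clique_cover_number V E \<le> max_anti_codeg V E + 2)"
proof (intro conjI allI impI)
  fix V :: "'a set" and E
  assume G: "finite_simple_graph V E \<and> independence_number V E \<le> 2"
  let ?E = "[V]\<^bsup>2\<^esup> - E"
  interpret triangle_free_graph V ?E
    using G triangle_free_complement by unfold_locales (auto simp: finite_simple_graph_def)
  have "[V]\<^bsup>2\<^esup> - ?E = E"
    using G by (auto simp: finite_simple_graph_def)
  then have "max_anti_codeg V ?E = max_codeg V E"
    by (simp add: max_anti_codeg_eq_max_codeg_complement)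
  then show "chromatic_number V E \<le> max_codeg V E + 2"
    using chromatic_number_le_clique_cover_number_complement[of V E] G clique_cover_number_le
    by simp
next
  fix V :: "'a set" and E
  assume "finite_simple_graph V E \<and> triangle_free V E"
  then interpret triangle_free_graph V E
    by unfold_locales auto
  show "clique_cover_number V E \<le> max_anti_codeg V E + 2"
    by (rule clique_cover_number_le)
qed

end
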